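(* Let $I=(p_1,\dots,p_s)$ be a proper ideal of $\Bbbk[Z]=\Bbbk[z_1,\dots,z_N]$, and for any $\mathcal{T}\subseteq[N]$ let $I_{\mathcal{T}}$ denote the ideal of $\Bbbk[Z_{\mathcal{T}}]$ generated by the subset $\{p_1,\dots,p_s\}\cap\Bbbk[Z_{\mathcal{T}}]$. Let $\Omega\subseteq[N]$. If there is a set $\mathcal{T}\subseteq[N]$ for which $$\operatorname{height}(I_{\mathcal{T}})>|\mathcal{T}\setminus\Omega|,$$ then $\Omega$ is not in the independence complex of $I$.
   Context: $\Bbbk$ is an infinite field, $[N]=\{1,\dots,N\}$, and $Z=\{z_1,\dots,z_N\}$ is a set of $N$ variables. For $\mathcal{T}\subseteq[N]$, $Z_{\mathcal{T}}=\{z_i : i\in\mathcal{T}\}$ and $\Bbbk[Z_{\mathcal{T}}]$ is the polynomial ring in these variables, in which the height of $I_{\mathcal{T}}$ is taken (the zero ideal has height $0$). The independence complex of an ideal $I\subseteq\Bbbk[Z]$ is the simplicial complex of all $\mathcal{T}\subseteq[N]$ with $I\cap\Bbbk[Z_{\mathcal{T}}]=0$. *)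

theory Defs
  imports "HOL-Algebra.Ideal" "HOL-Library.Poly_Mapping" "HOL-Library.Extended_Nat"
begin

text \<open>
  Polynomials with coefficients in \<open>'k\<close> in the variables \<open>z\<^sub>i\<close>, \<open>i :: nat\<close>: finitely supported maps
  from monomials (finitely supported exponent vectors) to coefficients, with the convolution
  product of \<^theory>\<open>HOL-Library.Poly_Mapping\<close>.
\<close>

type_synonym 'k mpoly = "(nat \<Rightarrow>\<^sub>0 nat) \<Rightarrow>\<^sub>0 'k"

text \<open>The polynomial ring in the variables \<open>z\<^sub>i\<close>, \<open>i \<in> V\<close>.\<close>

definition poly_ring :: "nat set \<Rightarrow> 'k::comm_ring_1 mpoly ring" where
  "poly_ring V =
    \<lparr>carrier = {p. \<forall>m\<in>Poly_Mapping.keys p. Poly_Mapping.keys m \<subseteq> V},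
     mult = (*), one = 1, zero = 0, add = (+)\<rparr>"

definition prime_height :: "('a, 'b) ring_scheme \<Rightarrow> 'a set \<Rightarrow> enat" where
  "prime_height R Q = Sup {enat n | n. \<exists>P :: nat \<Rightarrow> 'a set.
     (\<forall>i\<le>n. primeideal (P i) R) \<and> (\<forall>i<n. P i \<subset> P (Suc i)) \<and> P n = Q}"

text \<open>The unit ideal, contained in no prime ideal, has height \<open>\<infinity>\<close>.\<close>

definition height :: "('a, 'b) ring_scheme \<Rightarrow> 'a set \<Rightarrow> enat" where
  "height R J = (INF P \<in> {P. primeideal P R \<and> J \<subseteq> P}. prime_height R P)"

definition independence_complex :: "nat \<Rightarrow> 'k::comm_ring_1 mpoly set \<Rightarrow> nat set set" where
  "independence_complex N I = {T. T \<subseteq> {1..N} \<and> I \<inter> carrier (poly_ring T) = {0}}"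

lemma poly_ring_simps [simp]:
  "mult (poly_ring V) = (*)" "one (poly_ring V) = 1"
  "zero (poly_ring V) = 0" "add (poly_ring V) = (+)"
  by (simp_all add: poly_ring_def)

lemma in_poly_ring_iff:
  "p \<in> carrier (poly_ring V) \<longleftrightarrow> (\<forall>m\<in>Poly_Mapping.keys p. Poly_Mapping.keys m \<subseteq> V)"
  by (simp add: poly_ring_def)

lemma cring_poly_ring: "cring (poly_ring V :: 'k::comm_ring_1 mpoly ring)"
proof (rule cringI)
  let ?R = "poly_ring V :: 'k mpoly ring"
  have add: "p + q \<in> carrier ?R" if "p \<in> carrier ?R" "q \<in> carrier ?R" for p q
    using that Poly_Mapping.keys_add[of p q] by (auto simp: in_poly_ring_iff)
  have mult: "p * q \<in> carrier ?R" if pq: "p \<in> carrier ?R" "q \<in> carrier ?R" for p q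
  proof -
    have "Poly_Mapping.keys m \<subseteq> V" if m: "m \<in> Poly_Mapping.keys (p * q)" for m
    proof -
      obtain a b where "m = a + b" "a \<in> Poly_Mapping.keys p" "b \<in> Poly_Mapping.keys q"
        using subsetD[OF Poly_Mapping.keys_mult m] by auto
      then show ?thesis
        using pq Poly_Mapping.keys_add[of a b]
        by (fastforce simp: in_poly_ring_iff)
    qed
    then show ?thesis by (simp add: in_poly_ring_iff)
  qed
  have zero: "0 \<in> carrier ?R" and one: "1 \<in> carrier ?R"
    by (simp_all add: in_poly_ring_iff)
  have minus: "- p \<in> carrier ?R" if "p \<in> carrier ?R" for p
    using that by (simp add: in_poly_ring_iff)
  show "abelian_group ?R"
    by (rule abelian_groupI)
       (auto simp: add zero algebra_simps intro: bexI[OF _ minus])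
  show "Group.comm_monoid ?R"
    by (rule comm_monoidI) (auto simp: mult one algebra_simps)
  show "(x \<oplus>\<^bsub>?R\<^esub> y) \<otimes>\<^bsub>?R\<^esub> z = x \<otimes>\<^bsub>?R\<^esub> z \<oplus>\<^bsub>?R\<^esub> y \<otimes>\<^bsub>?R\<^esub> z" for x y z
    by (simp add: algebra_simps)
qed

lemma domain_poly_ring: "domain (poly_ring V :: 'k::idom mpoly ring)"
  by (intro domain.intro cring_poly_ring domain_axioms.intro) auto

lemma height_poly_ring_zero: "height (poly_ring V :: 'k::idom mpoly ring) {0} = 0"
proof -
  let ?R = "poly_ring V :: 'k mpoly ring"
  interpret domain ?R by (rule domain_poly_ring)
  have prime0: "primeideal {0} ?R"
    using zeroprimeideal by simp
  have "n = 0" if chain: "\<forall>i\<le>n. primeideal (P i) ?R" "\<forall>i<n. P i \<subset> P (Suc i)" "P n = {0}"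
    for n and P :: "nat \<Rightarrow> 'k mpoly set"
  proof (rule ccontr)
    assume "n \<noteq> 0"
    then have sub: "P (n - 1) \<subset> {0}" and pr: "primeideal (P (n - 1)) ?R"
      using chain by (metis Suc_pred' diff_less not_gr_zero zero_less_one, simp)
    have "0 \<in> P (n - 1)"
      using additive_subgroup.zero_closed[OF ideal.axioms(1)[OF primeideal.axioms(1)[OF pr]]]
      by simp
    with sub show False by blast
  qed
  then have "prime_height ?R {0} \<le> 0"
    unfolding prime_height_def by (intro Sup_least) (auto simp: zero_enat_def)
  moreover have "height ?R {0} \<le> prime_height ?R {0}"
    unfolding height_def by (rule INF_lower) (simp add: prime0)
  ultimately show ?thesis by simp
qed

end

theory Submission
  imports Defs "HOL-Algebra.Ring_Divisibility"
begin

text \<open>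
  Suppose that \<open>\<Omega>\<close> is in the independence complex and put \<open>A = T \<inter> \<Omega>\<close>. The ideal \<open>J\<close> of
  \<open>k[Z\<^sub>T]\<close> generated by those \<open>p\<^sub>i\<close> that lie in \<open>k[Z\<^sub>T]\<close> is contained in \<open>I\<close>, so
  \<open>J \<inter> k[Z\<^sub>A] = 0\<close>. Hence it suffices to show that an ideal \<open>J\<close> of \<open>k[Z\<^sub>T]\<close> with this property
  has height at most \<open>card (T - A)\<close> (\<open>height_le_if_independent\<close>).

  An ideal containing \<open>J\<close> that is maximal among those disjoint from the multiplicative set
  \<open>k[Z\<^sub>A] - {0}\<close> is a prime \<open>P\<close> (\<open>exists_primeideal_disjoint\<close>). The height of \<open>J\<close> is at most that
  of \<open>P\<close>, so what remains is to bound the length of a chain of primes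
  \<open>P\<^sub>0 \<subset> \<dots> \<subset> P\<^sub>n = P\<close>. Here the transcendence degree of the residue rings drops at every
  inclusion. In the form used below: if \<open>P \<subset> Q\<close> are primes and \<open>Q \<inter> k[Z\<^sub>A] = 0\<close>, then one more
  variable \<open>z\<^sub>t\<close> can be added to \<open>A\<close> such that \<open>P\<close> meets the larger polynomial ring only in \<open>0\<close>
  (\<open>exists_independent_insert\<close>). Going down the chain gives \<open>card A + n\<close> distinct elements of
  \<open>T\<close>, that is \<open>n \<le> card (T - A)\<close>.

  To find \<open>z\<^sub>t\<close>, assume that there is none. Then every variable, and therefore every element of
  \<open>k[Z\<^sub>T]\<close>, is algebraic over \<open>k[Z\<^sub>A]\<close> modulo \<open>P\<close>. Take \<open>f \<in> Q - P\<close> and a nontrivial relation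
  \<open>c\<^sub>0 + c\<^sub>1 f + \<dots> + c\<^sub>n f\<^sup>n \<in> P\<close> of least degree. Its constant term lies in \<open>Q \<inter> k[Z\<^sub>A] = 0\<close>,
  and since \<open>P\<close> is prime and \<open>f \<notin> P\<close>, the relation can be divided by \<open>f\<close>, a contradiction
  (\<open>not_algebraic_mod\<close>). That algebraic generators make all elements algebraic is linear algebra
  over the fraction field of \<open>k[Z\<^sub>A]\<close>, carried out with denominators cleared: finitely many
  products of powers of the variables span everything, and more vectors than the size of a
  spanning set are dependent (\<open>linear_dependence\<close>).
\<close>

section \<open>Prime ideals avoiding a multiplicative set\<close>

text \<open>
  An ideal maximal with respect to avoiding \<open>M\<close> is prime: if \<open>a\<close> and \<open>b\<close> are outside, then both
  \<open>P + (a)\<close> and \<open>P + (b)\<close> meet \<open>M\<close>, and the product of two such elements of \<open>M\<close> lies in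
  \<open>P + (a b)\<close>; as \<open>P\<close> avoids \<open>M\<close>, the element \<open>a b\<close> is outside \<open>P\<close>.
\<close>

lemma (in cring) exists_primeideal_disjoint:
  assumes J: "ideal J R" and M: "M \<subseteq> carrier R" "\<one> \<in> M"
    and M_mult: "\<And>x y. x \<in> M \<Longrightarrow> y \<in> M \<Longrightarrow> x \<otimes> y \<in> M"
    and disj: "J \<inter> M = {}"
  obtains P where "primeideal P R" "J \<subseteq> P" "P \<inter> M = {}"
proof -
  define F where "F = {I. ideal I R \<and> J \<subseteq> I \<and> I \<inter> M = {}}"
  have "\<exists>P\<in>F. \<forall>X\<in>F. P \<subseteq> X \<longrightarrow> X = P"
  proof (rule subset_Zorn)
    fix C assume C: "subset.chain F C"
    show "\<exists>U\<in>F. \<forall>X\<in>C. X \<subseteq> U"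
    proof (cases "C = {}")
      case True
      then show ?thesis using J disj by (auto simp: F_def)
    next
      case False
      have "subset.chain {I. ideal I R} C"
        using C by (auto simp: subset_chain_def F_def)
      from chain_Union_is_ideal[OF this] have "ideal (\<Union>C) R" using False by simp
      moreover have "\<Union>C \<inter> M = {}"
        using C by (auto simp: subset_chain_def F_def)
      moreover from False obtain X where "X \<in> C" by blast
      with C have "J \<subseteq> \<Union>C" unfolding subset_chain_def F_def by blast
      ultimately show ?thesis by (auto simp: F_def)
    qed
  qed
  then obtain P where P: "ideal P R" "J \<subseteq> P" "P \<inter> M = {}"
    and maximal: "\<And>X. X \<in> F \<Longrightarrow> P \<subseteq> X \<Longrightarrow> X = P"
    by (auto simp: F_def)
  interpret P: ideal P R by (rule P)
  \<comment> \<open>By maximality, adjoining an element outside \<open>P\<close> produces an element of \<open>M\<close>.\<close>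
  have meets: "\<exists>q\<in>P. \<exists>r\<in>carrier R. q \<oplus> r \<otimes> x \<in> M" if x: "x \<in> carrier R" "x \<notin> P" for x
  proof (rule ccontr)
    assume contra: "\<not> ?thesis"
    have ideal: "ideal (P <+>\<^bsub>R\<^esub> PIdl x) R"
      by (rule add_ideals[OF P(1) cgenideal_ideal[OF x(1)]])
    have sub: "P \<subseteq> P <+>\<^bsub>R\<^esub> PIdl x"
    proof
      fix y assume y: "y \<in> P"
      then have "y = y \<oplus> \<zero> \<otimes> x" using x P.a_subset by auto
      with y show "y \<in> P <+>\<^bsub>R\<^esub> PIdl x"
        unfolding set_add_def' cgenideal_def by blast
    qed
    have "x = \<zero> \<oplus> \<one> \<otimes> x" using x by simp
    then have "x \<in> P <+>\<^bsub>R\<^esub> PIdl x"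
      using P.zero_closed unfolding set_add_def' cgenideal_def by blast
    moreover have "(P <+>\<^bsub>R\<^esub> PIdl x) \<inter> M = {}"
      using contra unfolding set_add_def' cgenideal_def by blast
    ultimately show False
      using maximal[of "P <+>\<^bsub>R\<^esub> PIdl x"] ideal sub P(2) x(2) by (auto simp: F_def)
  qed
  have "primeideal P R"
  proof (rule primeidealI[OF P(1) cring_axioms])
    show "carrier R \<noteq> P" using P(3) M by auto
    fix a b assume ab: "a \<in> carrier R" "b \<in> carrier R" "a \<otimes> b \<in> P"
    show "a \<in> P \<or> b \<in> P"
    proof (rule ccontr)
      assume "\<not> (a \<in> P \<or> b \<in> P)"
      then obtain q r q' r' where
        qr: "q \<in> P" "r \<in> carrier R" "q \<oplus> r \<otimes> a \<in> M" and
        qr': "q' \<in> P" "r' \<in> carrier R" "q' \<oplus> r' \<otimes> b \<in> M"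
        using meets ab by metis
      have car: "q \<in> carrier R" "q' \<in> carrier R" using qr qr' P.a_subset by auto
      have "(q \<oplus> r \<otimes> a) \<otimes> (q' \<oplus> r' \<otimes> b)
          = (q' \<oplus> r' \<otimes> b) \<otimes> q \<oplus> ((r \<otimes> a) \<otimes> q' \<oplus> (r \<otimes> r') \<otimes> (a \<otimes> b))"
        using ab qr(2) qr'(2) car by algebra
      also have "\<dots> \<in> P"
        by (intro P.a_closed P.I_l_closed[OF qr(1)] P.I_l_closed[OF qr'(1)] P.I_l_closed[OF ab(3)])
           (use ab qr qr' M in auto)
      finally show False
        using M_mult[OF qr(3) qr'(3)] P(3) by blast
    qed
  qed
  with P that show ?thesis by blast
qed


section \<open>Linear dependence over a subring of a domain\<close>

locale domain_subring =
  fixes D :: "'a::idom set"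
  assumes D_zero: "0 \<in> D" and D_one: "1 \<in> D"
    and D_add: "x \<in> D \<Longrightarrow> y \<in> D \<Longrightarrow> x + y \<in> D"
    and D_uminus: "x \<in> D \<Longrightarrow> - x \<in> D"
    and D_mult: "x \<in> D \<Longrightarrow> y \<in> D \<Longrightarrow> x * y \<in> D"
begin

lemma D_diff: "x \<in> D \<Longrightarrow> y \<in> D \<Longrightarrow> x - y \<in> D"
  using D_add[of x "- y"] D_uminus by simp

lemma D_sum: "(\<And>i. i \<in> S \<Longrightarrow> f i \<in> D) \<Longrightarrow> sum f S \<in> D"
  by (induction S rule: infinite_finite_induct) (auto simp: D_zero D_add)

text \<open>
  Gaussian elimination without division: a vector \<open>v k\<close> with nonzero coordinate at \<open>b\<close> is used to
  clear this coordinate in all other vectors, and a relation between the resulting vectors \<open>w j\<close>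
  lifts to one between the \<open>v j\<close>.
\<close>

lemma linear_dependence:
  fixes v :: "'i \<Rightarrow> 'b \<Rightarrow> 'a"
  assumes "finite B" "finite J" "card B < card J" "\<And>j b. v j b \<in> D"
  shows "\<exists>c. (\<forall>j. c j \<in> D) \<and> (\<exists>j\<in>J. c j \<noteq> 0) \<and> (\<forall>b\<in>B. (\<Sum>j\<in>J. c j * v j b) = 0)"
  using assms
proof (induction B arbitrary: J v rule: finite_induct)
  case empty
  then have "J \<noteq> {}" by auto
  then show ?case using D_one by (intro exI[of _ "\<lambda>_. 1"]) auto
next
  case (insert b B)
  show ?case
  proof (cases "\<forall>j\<in>J. v j b = 0")
    case True
    then show ?thesis
      using insert.IH[of J v] insert.prems insert.hyps by auto
  next
    case False
    then obtain k where k: "k \<in> J" "v k b \<noteq> 0" by blast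
    define w where "w j b' = v k b * v j b' - v j b * v k b'" for j b'
    have w: "w j b' \<in> D" for j b'
      using insert.prems by (auto simp: w_def intro: D_diff D_mult)
    have "card B < card (J - {k})"
      using insert.prems insert.hyps k by simp
    from insert.IH[of "J - {k}" w, OF _ this w] insert.prems obtain c where
      c: "\<forall>j. c j \<in> D" "\<exists>j\<in>J - {k}. c j \<noteq> 0"
         "\<forall>b'\<in>B. (\<Sum>j\<in>J - {k}. c j * w j b') = 0" by blast
    \<comment> \<open>The coefficient at \<open>k\<close> collects the multiples of \<open>v k\<close> that are subtracted in \<open>w\<close>.\<close>
    define e where "e j = (if j = k then - (\<Sum>i\<in>J - {k}. c i * v i b) else c j * v k b)" for j
    have e_sum: "(\<Sum>j\<in>J. e j * v j b') = (\<Sum>j\<in>J - {k}. c j * w j b')" for b'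
    proof -
      have "(\<Sum>j\<in>J. e j * v j b') = e k * v k b' + (\<Sum>j\<in>J - {k}. e j * v j b')"
        using insert.prems k by (simp add: sum.remove)
      also have "(\<Sum>j\<in>J - {k}. e j * v j b') = (\<Sum>j\<in>J - {k}. c j * v k b * v j b')"
        by (intro sum.cong) (auto simp: e_def)
      also have "e k * v k b' = (\<Sum>j\<in>J - {k}. - (c j * v j b * v k b'))"
        by (simp add: e_def sum_distrib_right sum_negf)
      finally show ?thesis
        by (simp add: w_def sum.distrib[symmetric] algebra_simps)
    qed
    have "\<forall>j. e j \<in> D"
      using c(1) insert.prems by (auto simp: e_def intro!: D_uminus D_sum D_mult)
    moreover have "\<exists>j\<in>J. e j \<noteq> 0" using c(2) k by (auto simp: e_def)
    moreover have "(\<Sum>j\<in>J. e j * v j b') = 0" if "b' \<in> insert b B" for b'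
      using that c(3) unfolding e_sum by (auto simp: w_def)
    ultimately show ?thesis by blast
  qed
qed

end


section \<open>Algebraic dependence modulo an ideal\<close>

text \<open>
  The case of interest is \<open>D = k[Z\<^sub>A]\<close> and \<open>R = k[Z\<^sub>T]\<close> with an ideal \<open>P\<close> of \<open>R\<close>; the ambient
  type, all of whose elements are polynomials in arbitrary variables, provides the operations.
\<close>

locale domain_subring_ideal = domain_subring D for D :: "'a::idom set" +
  fixes R P :: "'a set"
  assumes D_sub: "D \<subseteq> R"
    and R_add: "x \<in> R \<Longrightarrow> y \<in> R \<Longrightarrow> x + y \<in> R"
    and R_mult: "x \<in> R \<Longrightarrow> y \<in> R \<Longrightarrow> x * y \<in> R"
    and P_zero: "0 \<in> P"
    and P_add: "x \<in> P \<Longrightarrow> y \<in> P \<Longrightarrow> x + y \<in> P"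
    and P_mult: "r \<in> R \<Longrightarrow> x \<in> P \<Longrightarrow> r * x \<in> P"
begin

lemma R_one: "1 \<in> R"
  using D_one D_sub by blast

lemma R_power: "x \<in> R \<Longrightarrow> x ^ n \<in> R"
  by (induction n) (auto simp: R_one R_mult)

lemma R_sum: "(\<And>i. i \<in> S \<Longrightarrow> f i \<in> R) \<Longrightarrow> sum f S \<in> R"
  using D_zero D_sub
  by (induction S rule: infinite_finite_induct) (auto intro: R_add)

lemma P_sum: "(\<And>i. i \<in> S \<Longrightarrow> f i \<in> P) \<Longrightarrow> sum f S \<in> P"
  by (induction S rule: infinite_finite_induct) (auto simp: P_zero P_add)

definition combinations :: "'a set \<Rightarrow> 'a set" where
  "combinations B = {(\<Sum>b\<in>B. a b * b) + q | a q. (\<forall>b. a b \<in> D) \<and> q \<in> P}"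

text \<open>
  This stands for the vector space spanned by \<open>B\<close> over the fraction field of \<open>D\<close>, modulo \<open>P\<close>.
  Moving the common denominator \<open>d\<close> of the coefficients to the side of \<open>x\<close> replaces the
  localisation at \<open>D - {0}\<close>.
\<close>

definition frac_span :: "'a set \<Rightarrow> 'a set" where
  "frac_span B = {x. \<exists>d\<in>D. d \<noteq> 0 \<and> d * x \<in> combinations B}"

lemma combinationsI:
  "(\<And>b. a b \<in> D) \<Longrightarrow> q \<in> P \<Longrightarrow> (\<Sum>b\<in>B. a b * b) + q \<in> combinations B"
  by (auto simp: combinations_def)

lemma combinations_add:
  assumes "x \<in> combinations B" "y \<in> combinations B"
  shows "x + y \<in> combinations B"
proof -
  from assms obtain a q a' q' where
    "x = (\<Sum>b\<in>B. a b * b) + q" "y = (\<Sum>b\<in>B. a' b * b) + q'"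
    and *: "\<And>b. a b \<in> D" "\<And>b. a' b \<in> D" "q \<in> P" "q' \<in> P"
    by (auto simp: combinations_def)
  then have "x + y = (\<Sum>b\<in>B. (a b + a' b) * b) + (q + q')"
    by (simp add: algebra_simps sum.distrib)
  then show ?thesis using combinationsI * D_add P_add by presburger
qed

lemma combinations_mult:
  assumes "d \<in> D" "x \<in> combinations B"
  shows "d * x \<in> combinations B"
proof -
  from assms obtain a q where "x = (\<Sum>b\<in>B. a b * b) + q" and *: "\<And>b. a b \<in> D" "q \<in> P"
    by (auto simp: combinations_def)
  then have "d * x = (\<Sum>b\<in>B. (d * a b) * b) + d * q"
    by (simp add: algebra_simps sum_distrib_left)
  moreover have "d * q \<in> P" using assms D_sub * by (auto intro: P_mult)
  ultimately show ?thesis using combinationsI * D_mult assms by presburger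
qed

lemma combinations_subset_frac_span: "combinations B \<subseteq> frac_span B"
  unfolding frac_span_def using D_one by (auto intro!: bexI[of _ 1])

lemma P_subset_frac_span: "P \<subseteq> frac_span B"
proof
  fix q assume "q \<in> P"
  then have "(\<Sum>b\<in>B. 0 * b) + q \<in> combinations B" by (intro combinationsI D_zero)
  then show "q \<in> frac_span B" using combinations_subset_frac_span by auto
qed

lemma generator_in_frac_span:
  assumes "finite B" "b \<in> B"
  shows "b \<in> frac_span B"
proof -
  have "(\<Sum>c\<in>B. (if c = b then 1 else 0) * c) + 0 \<in> combinations B"
    by (rule combinationsI) (auto simp: D_zero D_one P_zero)
  moreover have "(\<Sum>c\<in>B. (if c = b then 1 else 0) * c) = b"
    using assms by (simp add: if_distrib[of "\<lambda>u. u * _"] sum.delta cong: if_cong)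
  ultimately show ?thesis using combinations_subset_frac_span by auto
qed

lemma frac_span_add:
  assumes "x \<in> frac_span B" "y \<in> frac_span B"
  shows "x + y \<in> frac_span B"
proof -
  from assms obtain d e where
    "d \<in> D" "d \<noteq> 0" "d * x \<in> combinations B" "e \<in> D" "e \<noteq> 0" "e * y \<in> combinations B"
    by (auto simp: frac_span_def)
  moreover from this have "e * (d * x) + d * (e * y) \<in> combinations B"
    by (simp add: combinations_add combinations_mult)
  moreover have "e * (d * x) + d * (e * y) = (d * e) * (x + y)" by (simp add: algebra_simps)
  ultimately show ?thesis
    by (auto simp: frac_span_def D_mult intro!: bexI[of _ "d * e"])
qed

lemma frac_span_mult:
  assumes "c \<in> D" "x \<in> frac_span B"
  shows "c * x \<in> frac_span B"
proof -
  from assms obtain d where "d \<in> D" "d \<noteq> 0" "d * x \<in> combinations B"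
    by (auto simp: frac_span_def)
  then show ?thesis
    using combinations_mult[OF assms(1), of "d * x"]
    by (auto simp: frac_span_def mult.left_commute intro!: bexI[of _ d])
qed

lemma frac_span_divide:
  assumes "c \<in> D" "c \<noteq> 0" "c * x \<in> frac_span B"
  shows "x \<in> frac_span B"
proof -
  from assms obtain d where "d \<in> D" "d \<noteq> 0" "d * (c * x) \<in> combinations B"
    by (auto simp: frac_span_def)
  then show ?thesis
    using assms by (auto simp: frac_span_def D_mult mult.assoc intro!: bexI[of _ "d * c"])
qed

lemma frac_span_sum: "(\<And>i. i \<in> S \<Longrightarrow> f i \<in> frac_span B) \<Longrightarrow> sum f S \<in> frac_span B"
  using P_zero P_subset_frac_span
  by (induction S rule: infinite_finite_induct) (auto intro: frac_span_add)

text \<open>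
  Multiplying out one factor at a time keeps each step linear over \<open>D\<close>: first \<open>b * y\<close> for a
  single \<open>b \<in> B\<close>, then \<open>x * y\<close>. The set \<open>B\<close> and \<open>y\<close> must lie in \<open>R\<close> because the remainders in \<open>P\<close>
  get multiplied by them.
\<close>

lemma frac_span_times:
  assumes fin: "finite B" "finite C" and sub: "B \<subseteq> R"
    and x: "x \<in> frac_span B" and y: "y \<in> frac_span C" "y \<in> R"
  shows "x * y \<in> frac_span ((\<lambda>(b, c). b * c) ` (B \<times> C))" (is "_ \<in> frac_span ?BC")
proof -
  have gen: "b * c \<in> frac_span ?BC" if "b \<in> B" "c \<in> C" for b c
    using that fin by (intro generator_in_frac_span) auto
  have shift: "b * y \<in> frac_span ?BC" if b: "b \<in> B" for b
  proof -
    from y obtain d a q where d: "d \<in> D" "d \<noteq> 0" "d * y = (\<Sum>c\<in>C. a c * c) + q"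
      and *: "\<And>c. a c \<in> D" "q \<in> P"
      by (auto simp: frac_span_def combinations_def)
    have "d * (b * y) = b * (d * y)" by (simp add: algebra_simps)
    also have "\<dots> = (\<Sum>c\<in>C. a c * (b * c)) + b * q"
      by (simp add: d algebra_simps sum_distrib_left)
    also have "\<dots> \<in> frac_span ?BC"
    proof (rule frac_span_add)
      show "(\<Sum>c\<in>C. a c * (b * c)) \<in> frac_span ?BC"
        by (intro frac_span_sum frac_span_mult * gen b)
      show "b * q \<in> frac_span ?BC"
        using P_subset_frac_span P_mult[OF _ *(2)] b sub by blast
    qed
    finally show ?thesis using frac_span_divide d by blast
  qed
  from x obtain d a q where d: "d \<in> D" "d \<noteq> 0" "d * x = (\<Sum>b\<in>B. a b * b) + q"
    and *: "\<And>b. a b \<in> D" "q \<in> P"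
    by (auto simp: frac_span_def combinations_def)
  have "d * (x * y) = (d * x) * y" by (simp add: algebra_simps)
  also have "\<dots> = (\<Sum>b\<in>B. a b * (b * y)) + y * q"
    by (simp add: d algebra_simps sum_distrib_left)
  also have "\<dots> \<in> frac_span ?BC"
  proof (rule frac_span_add)
    show "(\<Sum>b\<in>B. a b * (b * y)) \<in> frac_span ?BC"
      by (intro frac_span_sum frac_span_mult * shift)
    show "y * q \<in> frac_span ?BC"
      using P_subset_frac_span P_mult[OF y(2) *(2)] by blast
  qed
  finally show ?thesis using frac_span_divide d by blast
qed

definition algebraic_mod :: "'a \<Rightarrow> bool" where
  "algebraic_mod f \<longleftrightarrow>
    (\<exists>n c. (\<forall>i. c i \<in> D) \<and> (\<exists>i\<le>n. c i \<noteq> 0) \<and> (\<Sum>i\<le>n. c i * f ^ i) \<in> P)"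

lemma algebraic_mod_if_powers_in_frac_span:
  assumes "finite B" and pow: "\<And>n. f ^ n \<in> frac_span B"
  shows "algebraic_mod f"
proof -
  have "\<exists>d a. d \<in> D \<and> d \<noteq> 0 \<and> (\<forall>b. a b \<in> D) \<and> d * f ^ n - (\<Sum>b\<in>B. a b * b) \<in> P" for n
    using pow[of n] by (auto simp: frac_span_def combinations_def) (metis add_diff_cancel_left')
  then obtain d a where
    d: "\<And>n. d n \<in> D" "\<And>n. d n \<noteq> 0" and
    a: "\<And>n b. a n b \<in> D" and rest: "\<And>n. d n * f ^ n - (\<Sum>b\<in>B. a n b * b) \<in> P"
    by meson
  define q where "q n = d n * f ^ n - (\<Sum>b\<in>B. a n b * b)" for n
  have eq: "d n * f ^ n = (\<Sum>b\<in>B. a n b * b) + q n" for n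
    by (simp add: q_def)
  \<comment> \<open>\<open>card B + 1\<close> powers of \<open>f\<close> in a space spanned by \<open>B\<close>\<close>
  define n where "n = card B"
  obtain c where c: "\<And>j. c j \<in> D" "\<exists>j\<in>{..n}. c j \<noteq> 0"
    "\<forall>b\<in>B. (\<Sum>j\<in>{..n}. c j * a j b) = 0"
    using linear_dependence[of B "{..n}" a] assms(1) a by (auto simp: n_def)
  have "(\<Sum>j\<le>n. (c j * d j) * f ^ j) = (\<Sum>j\<le>n. c j * (\<Sum>b\<in>B. a j b * b) + c j * q j)"
    by (intro sum.cong refl) (simp add: eq mult.assoc distrib_left)
  also have "\<dots> = (\<Sum>j\<le>n. \<Sum>b\<in>B. c j * a j b * b) + (\<Sum>j\<le>n. c j * q j)"
    by (simp add: sum.distrib sum_distrib_left mult.assoc)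
  also have "(\<Sum>j\<le>n. \<Sum>b\<in>B. c j * a j b * b) = (\<Sum>b\<in>B. (\<Sum>j\<le>n. c j * a j b) * b)"
    by (subst sum.swap) (simp add: sum_distrib_right)
  also have "\<dots> = 0" using c(3) by simp
  also have "0 + (\<Sum>j\<le>n. c j * q j) \<in> P"
    unfolding add_0 by (intro P_sum P_mult rest[folded q_def] subsetD[OF D_sub] c(1))
  finally have "(\<Sum>j\<le>n. (c j * d j) * f ^ j) \<in> P" .
  moreover have "\<exists>j\<le>n. c j * d j \<noteq> 0" using c(2) d by auto
  ultimately show ?thesis
    unfolding algebraic_mod_def using c(1) d(1)
    by (intro exI[of _ n] exI[of _ "\<lambda>j. c j * d j"]) (auto intro: D_mult)
qed

text \<open>
  A relation of degree \<open>d\<close> expresses \<open>t\<^sup>d\<close>, up to its leading coefficient, by lower powers;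
  multiplied by \<open>t\<^sup>k\<close> it reduces \<open>t\<^sup>d\<^sup>+\<^sup>k\<close> in the same way.
\<close>

lemma powers_in_frac_span_if_algebraic_mod:
  assumes alg: "algebraic_mod t" and t: "t \<in> R"
  obtains d where "\<And>n. t ^ n \<in> frac_span ((\<lambda>i. t ^ i) ` {..<d})"
proof -
  from alg obtain N c where c: "\<And>i. c i \<in> D" "\<exists>i\<le>N. c i \<noteq> 0" "(\<Sum>i\<le>N. c i * t ^ i) \<in> P"
    unfolding algebraic_mod_def by blast
  define d where "d = Max {i. i \<le> N \<and> c i \<noteq> 0}"
  have "d \<in> {i. i \<le> N \<and> c i \<noteq> 0}" unfolding d_def using c(2) by (intro Max_in) auto
  then have d: "d \<le> N" "c d \<noteq> 0" by auto
  have zero: "c i = 0" if "d < i" "i \<le> N" for i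
    using that Max_ge[of "{i. i \<le> N \<and> c i \<noteq> 0}" i] unfolding d_def by fastforce
  have "(\<Sum>i\<le>N. c i * t ^ i) = (\<Sum>i\<le>d. c i * t ^ i)"
    using d zero by (intro sum.mono_neutral_right) auto
  then have rel: "(\<Sum>i<d. c i * t ^ i) + c d * t ^ d \<in> P"
    using c(3) by (simp add: lessThan_Suc_atMost[symmetric])
  let ?B = "(\<lambda>i. t ^ i) ` {..<d}"
  have "t ^ n \<in> frac_span ?B" for n
  proof (induction n rule: less_induct)
    case (less n)
    show ?case
    proof (cases "n < d")
      case True
      then show ?thesis by (intro generator_in_frac_span) auto
    next
      case False
      define k where "k = n - d"
      have n: "n = k + d" using False by (simp add: k_def)
      have "c d * t ^ n = t ^ k * ((\<Sum>i<d. c i * t ^ i) + c d * t ^ d)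
              + (\<Sum>i<d. (- c i) * t ^ (k + i))"
        by (simp add: n algebra_simps power_add sum_distrib_left sum_negf)
      also have "\<dots> \<in> frac_span ?B"
      proof (rule frac_span_add)
        show "t ^ k * ((\<Sum>i<d. c i * t ^ i) + c d * t ^ d) \<in> frac_span ?B"
          using P_subset_frac_span P_mult[OF R_power[OF t] rel] by blast
        show "(\<Sum>i<d. (- c i) * t ^ (k + i)) \<in> frac_span ?B"
          by (intro frac_span_sum frac_span_mult D_uminus c(1) less.IH) (simp add: n)
      qed
      finally show ?thesis using frac_span_divide c(1) d by blast
    qed
  qed
  then show ?thesis by (rule that)
qed

text \<open>
  A relation for \<open>f\<close> modulo \<open>P\<close> holds modulo \<open>Q\<close> as well, where \<open>f\<close> vanishes, so its constant term
  lies in \<open>D \<inter> Q\<close> and is \<open>0\<close>. As \<open>P\<close> is prime and \<open>f \<notin> P\<close>, a factor \<open>f\<close> can be cancelled, and by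
  induction on the degree all coefficients vanish.
\<close>

lemma not_algebraic_mod:
  assumes Q_add: "\<And>x y. x \<in> Q \<Longrightarrow> y \<in> Q \<Longrightarrow> x + y \<in> Q"
    and Q_mult: "\<And>r x. r \<in> R \<Longrightarrow> x \<in> Q \<Longrightarrow> r * x \<in> Q"
    and PQ: "P \<subseteq> Q" and DQ: "D \<inter> Q \<subseteq> {0}"
    and prime: "\<And>x y. x \<in> R \<Longrightarrow> y \<in> R \<Longrightarrow> x * y \<in> P \<Longrightarrow> x \<in> P \<or> y \<in> P"
    and f: "f \<in> Q" "f \<notin> P" "f \<in> R"
  shows "\<not> algebraic_mod f"
proof -
  have "\<forall>i\<le>n. c i = 0" if "\<And>i. c i \<in> D" "(\<Sum>i\<le>n. c i * f ^ i) \<in> P" for n c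
    using that
  proof (induction n arbitrary: c)
    case 0
    then show ?case using PQ DQ by auto
  next
    case (Suc n)
    let ?g = "\<Sum>i\<le>n. c (Suc i) * f ^ i"
    have g: "?g \<in> R"
      using Suc.prems D_sub f by (intro R_sum R_mult R_power) auto
    have split: "(\<Sum>i\<le>Suc n. c i * f ^ i) = c 0 + f * ?g"
      by (simp only: sum.atMost_Suc_shift) (simp add: sum_distrib_left algebra_simps)
    have "- 1 \<in> R" using D_uminus[OF D_one] D_sub by auto
    then have "- ?g \<in> R" using R_mult[of "- 1" ?g] g by simp
    moreover have in_P: "c 0 + f * ?g \<in> P" using Suc.prems(2) by (simp only: split)
    \<comment> \<open>Subtracting the multiple \<open>f * ?g\<close> of \<open>f\<close>, which lies in \<open>Q\<close>, isolates the constant term.\<close>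
    ultimately have "(c 0 + f * ?g) + (- ?g) * f \<in> Q"
      using Q_add[OF subsetD[OF PQ in_P] Q_mult[OF _ f(1)]] by blast
    then have "c 0 \<in> Q" by (simp add: algebra_simps)
    then have c0: "c 0 = 0" using Suc.prems(1) DQ by auto
    then have "?g \<in> P" using prime[OF f(3) g] f(2) in_P by auto
    from Suc.IH[of "\<lambda>i. c (Suc i)", OF _ this] Suc.prems(1)
    have "\<forall>i\<le>n. c (Suc i) = 0" by simp
    with c0 show ?case by (metis Suc_le_mono not0_implies_Suc)
  qed
  then show ?thesis unfolding algebraic_mod_def by metis
qed

end


section \<open>Polynomial rings\<close>

definition indeterminate :: "nat \<Rightarrow> 'k::comm_ring_1 mpoly" where
  "indeterminate t = Poly_Mapping.single (Poly_Mapping.single t 1) 1"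

lemma indeterminate_power:
  "indeterminate t ^ n = (Poly_Mapping.single (Poly_Mapping.single t n) 1 :: 'k::comm_ring_1 mpoly)"
proof (induction n)
  case (Suc n)
  have "Poly_Mapping.single t (Suc n) = Poly_Mapping.single t 1 + Poly_Mapping.single t n"
    by (simp add: single_add[symmetric])
  with Suc show ?case by (simp add: mult_single indeterminate_def)
qed simp

lemma indeterminate_in_poly_ring:
  "t \<in> V \<Longrightarrow> (indeterminate t :: 'k::comm_ring_1 mpoly) \<in> carrier (poly_ring V)"
  by (auto simp: in_poly_ring_iff indeterminate_def)

lemma poly_ring_mono: "U \<subseteq> V \<Longrightarrow> carrier (poly_ring U) \<subseteq> carrier (poly_ring V)"
  unfolding subset_iff[of "carrier _"] in_poly_ring_iff by blast

lemma poly_ring_insert_induct [consumes 1, case_names zero add monom]: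
  fixes p :: "'k::comm_ring_1 mpoly"
  assumes p: "p \<in> carrier (poly_ring (insert t U))"
    and zero: "S 0" and add: "\<And>x y. S x \<Longrightarrow> S y \<Longrightarrow> S (x + y)"
    and monom: "\<And>a n. a \<in> carrier (poly_ring U) \<Longrightarrow> S (a * indeterminate t ^ n)"
  shows "S p"
proof -
  have one_term: "S (Poly_Mapping.single m (Poly_Mapping.lookup p m))" if m: "m \<in> Poly_Mapping.keys p" for m
  proof -
    define n where "n = Poly_Mapping.lookup m t"
    define m' where "m' = m - Poly_Mapping.single t n"
    have split: "m = m' + Poly_Mapping.single t n"
      by (rule poly_mapping_eqI)
         (auto simp: m'_def n_def lookup_add lookup_minus lookup_single when_def)
    have "Poly_Mapping.keys m' \<subseteq> U"
    proof
      fix i assume "i \<in> Poly_Mapping.keys m'"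
      then have "Poly_Mapping.lookup m i - (n when t = i) \<noteq> 0"
        by (simp add: m'_def in_keys_iff lookup_minus lookup_single)
      then have "i \<noteq> t" "i \<in> Poly_Mapping.keys m"
        by (auto simp: n_def in_keys_iff when_def split: if_splits)
      then show "i \<in> U" using p m by (auto simp: in_poly_ring_iff)
    qed
    then have "Poly_Mapping.single m' (Poly_Mapping.lookup p m) \<in> carrier (poly_ring U)"
      by (auto simp: in_poly_ring_iff)
    from monom[OF this, of n] show ?thesis
      by (simp add: indeterminate_power mult_single split[symmetric])
  qed
  have sum: "S (\<Sum>m\<in>M. Poly_Mapping.single m (Poly_Mapping.lookup p m))" if "M \<subseteq> Poly_Mapping.keys p" for M
    using finite_subset[OF that finite_keys] that
    by (induction M rule: finite_induct) (auto intro: zero add one_term)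
  have "p = (\<Sum>m\<in>Poly_Mapping.keys p. Poly_Mapping.single m (Poly_Mapping.lookup p m))"
    by (rule poly_mapping_eqI)
       (auto simp: lookup_sum lookup_single when_def in_keys_iff sum.delta)
  with sum[of "Poly_Mapping.keys p"] show ?thesis by simp
qed

lemma poly_ring_insert_expansion:
  fixes p :: "'k::comm_ring_1 mpoly"
  assumes "p \<in> carrier (poly_ring (insert t U))"
  shows "\<exists>n a. (\<forall>i. a i \<in> carrier (poly_ring U)) \<and> (\<forall>i>n. a i = 0) \<and>
           p = (\<Sum>i\<le>n. a i * indeterminate t ^ i)"
  using assms
proof (induction rule: poly_ring_insert_induct)
  case zero
  show ?case by (intro exI[of _ 0] exI[of _ "\<lambda>_. 0"]) (auto simp: in_poly_ring_iff)
next
  case (add x y)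
  interpret U: cring "poly_ring U :: 'k mpoly ring" by (rule cring_poly_ring)
  from add obtain n a n' a' where
    a: "\<forall>i. a i \<in> carrier (poly_ring U)" "\<forall>i>n. a i = 0"
       "x = (\<Sum>i\<le>n. a i * indeterminate t ^ i)" and
    a': "\<forall>i. a' i \<in> carrier (poly_ring U)" "\<forall>i>n'. a' i = 0"
       "y = (\<Sum>i\<le>n'. a' i * indeterminate t ^ i)" by blast
  define N where "N = max n n'"
  have "x = (\<Sum>i\<le>N. a i * indeterminate t ^ i)" "y = (\<Sum>i\<le>N. a' i * indeterminate t ^ i)"
    unfolding a(3) a'(3) using a(2) a'(2)
    by (auto simp: N_def intro!: sum.mono_neutral_left) (metis linorder_not_le mult_zero_left)+
  then have "x + y = (\<Sum>i\<le>N. (a i + a' i) * indeterminate t ^ i)"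
    by (simp add: sum.distrib distrib_right)
  moreover have "\<forall>i. a i + a' i \<in> carrier (poly_ring U)"
    using U.a_closed a(1) a'(1) by simp
  ultimately show ?case
    using a(2) a'(2) by (intro exI[of _ N] exI[of _ "\<lambda>i. a i + a' i"]) (auto simp: N_def)
next
  case (monom b n)
  then show ?case
    by (intro exI[of _ n] exI[of _ "\<lambda>i. if i = n then b else 0"])
       (auto simp: in_poly_ring_iff if_distrib[of "\<lambda>u. u * _"] cong: if_cong)
qed

lemma ideal_Int_poly_ring:
  fixes I :: "'k::comm_ring_1 mpoly set"
  assumes "V \<subseteq> W" and "ideal I (poly_ring W)"
  shows "ideal (I \<inter> carrier (poly_ring V)) (poly_ring V)"
proof (rule idealI)
  interpret V: cring "poly_ring V :: 'k mpoly ring" by (rule cring_poly_ring)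
  interpret I: ideal I "poly_ring W" by fact
  have sub: "x \<in> carrier (poly_ring W)" if "x \<in> carrier (poly_ring V)" for x :: "'k mpoly"
    using that poly_ring_mono[OF assms(1)] by blast
  show "Ring.ring (poly_ring V :: 'k mpoly ring)" by (rule V.ring_axioms)
  show "subgroup (I \<inter> carrier (poly_ring V)) (add_monoid (poly_ring V))"
  proof (rule V.add.subgroupI)
    show "I \<inter> carrier (poly_ring V) \<noteq> {}"
      using additive_subgroup.zero_closed[OF I.is_additive_subgroup] V.zero_closed by auto
    fix a assume a: "a \<in> I \<inter> carrier (poly_ring V)"
    \<comment> \<open>Negation in either ring is multiplication by the same constant.\<close>
    have "- 1 \<in> carrier (poly_ring V :: 'k mpoly ring)" by (simp add: in_poly_ring_iff)
    then have "- a \<in> I" using I.I_l_closed[of a "- 1"] a sub by simp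
    moreover have "\<ominus>\<^bsub>poly_ring V\<^esub> a = - a"
      using V.minus_equality[of "- a" a] a by (simp add: in_poly_ring_iff)
    ultimately show "\<ominus>\<^bsub>poly_ring V\<^esub> a \<in> I \<inter> carrier (poly_ring V)"
      using a V.a_inv_closed[of a] by simp
  qed (use additive_subgroup.a_closed[OF I.is_additive_subgroup] V.a_closed in auto)
  show "x \<otimes>\<^bsub>poly_ring V\<^esub> a \<in> I \<inter> carrier (poly_ring V)"
    "a \<otimes>\<^bsub>poly_ring V\<^esub> x \<in> I \<inter> carrier (poly_ring V)"
    if "a \<in> I \<inter> carrier (poly_ring V)" "x \<in> carrier (poly_ring V)" for a x
    using that sub I.I_l_closed[of a x] I.I_r_closed[of a x] V.m_closed by auto
qed

lemma domain_subring_ideal_poly_ring: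
  fixes P :: "'k::idom mpoly set"
  assumes "A \<subseteq> T" and "ideal P (poly_ring T)"
  shows "domain_subring_ideal (carrier (poly_ring A)) (carrier (poly_ring T)) P"
proof -
  interpret A: cring "poly_ring A :: 'k mpoly ring" by (rule cring_poly_ring)
  interpret T: cring "poly_ring T :: 'k mpoly ring" by (rule cring_poly_ring)
  interpret P: ideal P "poly_ring T" by fact
  show ?thesis
  proof
    show "carrier (poly_ring A) \<subseteq> carrier (poly_ring T)"
      by (rule poly_ring_mono) fact
    show "- x \<in> carrier (poly_ring A)" if "x \<in> carrier (poly_ring A)" for x :: "'k mpoly"
      using that by (simp add: in_poly_ring_iff)
  qed (use A.zero_closed A.one_closed A.a_closed A.m_closed T.a_closed T.m_closed
         P.zero_closed P.a_closed P.I_l_closed in simp_all)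
qed


section \<open>Chains of primes and independent sets of variables\<close>

text \<open>
  This is the drop of the transcendence degree along \<open>P \<subset> Q\<close>. If no variable could be added, all
  variables, and with them all elements of \<open>k[Z\<^sub>T]\<close>, would be algebraic over \<open>k[Z\<^sub>A]\<close> modulo \<open>P\<close>;
  but elements of \<open>Q - P\<close> are not.
\<close>

lemma exists_independent_insert:
  fixes P Q :: "'k::idom mpoly set"
  assumes T: "finite T" "A \<subseteq> T"
    and P: "primeideal P (poly_ring T)" and Q: "ideal Q (poly_ring T)"
    and PQ: "P \<subset> Q" and indep: "Q \<inter> carrier (poly_ring A) = {0}"
  shows "\<exists>t\<in>T - A. P \<inter> carrier (poly_ring (insert t A)) = {0}"
proof (rule ccontr)
  assume contra: "\<not> ?thesis"
  interpret P: primeideal P "poly_ring T" by fact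
  interpret Q: ideal Q "poly_ring T" by fact
  let ?D = "carrier (poly_ring A) :: 'k mpoly set"
  interpret domain_subring_ideal ?D "carrier (poly_ring T)" P
    using T(2) P.is_ideal by (rule domain_subring_ideal_poly_ring)
  have indeterminates: "algebraic_mod (indeterminate t)" if t: "t \<in> T - A" for t
  proof -
    obtain h where h: "h \<in> P" "h \<in> carrier (poly_ring (insert t A))" "h \<noteq> 0"
    proof -
      have "0 \<in> P \<inter> carrier (poly_ring (insert t A))" using P_zero by (simp add: in_poly_ring_iff)
      then show ?thesis using contra t that by blast
    qed
    from poly_ring_insert_expansion[OF h(2)] obtain n a where
      a: "\<forall>i. a i \<in> ?D" "h = (\<Sum>i\<le>n. a i * indeterminate t ^ i)" by blast
    moreover have "\<exists>i\<le>n. a i \<noteq> 0"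
      using h(3) unfolding a(2) by (auto intro: ccontr)
    ultimately show ?thesis using h(1) unfolding algebraic_mod_def by blast
  qed
  \<comment> \<open>Adding one variable at a time, a finite set spans over the fraction field of \<open>k[Z\<^sub>A]\<close>.\<close>
  have "\<exists>B. finite B \<and> B \<subseteq> carrier (poly_ring T) \<and> carrier (poly_ring (A \<union> U)) \<subseteq> frac_span B"
    if "finite U" "U \<subseteq> T - A" for U
    using that
  proof (induction U rule: finite_induct)
    case empty
    have "x \<in> frac_span {1}" if "x \<in> ?D" for x
      using frac_span_mult[OF that generator_in_frac_span[of "{1}" 1]] by simp
    then show ?case using R_one by (intro exI[of _ "{1}"]) auto
  next
    case (insert t U)
    then obtain B where B: "finite B" "B \<subseteq> carrier (poly_ring T)"
      "carrier (poly_ring (A \<union> U)) \<subseteq> frac_span B" by auto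
    let ?t = "indeterminate t :: 'k mpoly"
    have t: "?t \<in> carrier (poly_ring T)"
      using insert.prems by (intro indeterminate_in_poly_ring) auto
    obtain d where d: "\<And>n. ?t ^ n \<in> frac_span ((\<lambda>i. ?t ^ i) ` {..<d})"
      using powers_in_frac_span_if_algebraic_mod[OF indeterminates t] insert.prems by auto
    let ?C = "(\<lambda>(b, c). b * c) ` (B \<times> (\<lambda>i. ?t ^ i) ` {..<d})"
    have "x \<in> frac_span ?C" if "x \<in> carrier (poly_ring (insert t (A \<union> U)))" for x
      using that
    proof (induction rule: poly_ring_insert_induct)
      case zero
      show ?case using P_zero P_subset_frac_span by blast
    next
      case (add x y)
      then show ?case by (rule frac_span_add)
    next
      case (monom a n)
      then show ?case
        using B d R_power[OF t] by (intro frac_span_times) auto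
    qed
    moreover have "?C \<subseteq> carrier (poly_ring T)"
      using B(2) t by (auto intro!: R_mult R_power)
    ultimately show ?case using B(1) by (intro exI[of _ ?C]) auto
  qed
  from this[of "T - A"] T obtain B where
    B: "finite B" "carrier (poly_ring T) \<subseteq> frac_span B" by (auto simp: Un_absorb1)
  obtain f where f: "f \<in> Q" "f \<notin> P" using PQ by blast
  have fT: "f \<in> carrier (poly_ring T)" using f Q.a_subset by auto
  \<comment> \<open>The powers of \<open>f\<close> all lie in the span of the finite set \<open>B\<close>, so they are dependent.\<close>
  have "algebraic_mod f"
    by (rule algebraic_mod_if_powers_in_frac_span[OF B(1)]) (use B(2) R_power[OF fT] in blast)
  moreover have "\<not> algebraic_mod f"
  proof (rule not_algebraic_mod[of Q])
    show "x + y \<in> Q" if "x \<in> Q" "y \<in> Q" for x y using Q.a_closed[OF that] by simp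
    show "r * x \<in> Q" if "r \<in> carrier (poly_ring T)" "x \<in> Q" for r x
      using Q.I_l_closed[OF that(2,1)] by simp
    show "x \<in> P \<or> y \<in> P"
      if "x \<in> carrier (poly_ring T)" "y \<in> carrier (poly_ring T)" "x * y \<in> P" for x y
      using P.I_prime[OF that(1,2)] that(3) by simp
  qed (use PQ indep f fT in auto)
  ultimately show False by blast
qed

text \<open>Each step down the chain enlarges \<open>A\<close> by a variable, and \<open>A\<close> stays inside \<open>T\<close>.\<close>

lemma independent_prime_chain_bound:
  fixes P :: "nat \<Rightarrow> 'k::idom mpoly set"
  assumes T: "finite T" and A: "A \<subseteq> T" "P n \<inter> carrier (poly_ring A) = {0}"
    and chain: "\<forall>i\<le>n. primeideal (P i) (poly_ring T)" "\<forall>i<n. P i \<subset> P (Suc i)"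
  shows "card A + n \<le> card T"
  using A chain
proof (induction n arbitrary: A)
  case 0
  then show ?case using T by (simp add: card_mono)
next
  case (Suc n)
  have "ideal (P (Suc n)) (poly_ring T)"
    using Suc.prems(3) by (auto intro: primeideal.axioms(1))
  then obtain t where t: "t \<in> T - A" "P n \<inter> carrier (poly_ring (insert t A)) = {0}"
    using exists_independent_insert[OF T Suc.prems(1), of "P n" "P (Suc n)"] Suc.prems by auto
  have "card (insert t A) + n \<le> card T"
    using t Suc.prems by (intro Suc.IH) auto
  moreover have "card (insert t A) = Suc (card A)"
    using t finite_subset[OF Suc.prems(1) T] by simp
  ultimately show ?case by simp
qed

text \<open>
  The height of \<open>J\<close> is an infimum over all primes above it, so one prime that still meets
  \<open>k[Z\<^sub>A]\<close> only in \<open>0\<close> suffices.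
\<close>

lemma height_le_if_independent:
  fixes J :: "'k::idom mpoly set"
  assumes T: "finite T" "A \<subseteq> T" and J: "ideal J (poly_ring T)"
    and indep: "J \<inter> carrier (poly_ring A) = {0}"
  shows "height (poly_ring T) J \<le> enat (card (T - A))"
proof -
  interpret A: domain "poly_ring A :: 'k mpoly ring" by (rule domain_poly_ring)
  interpret T: domain "poly_ring T :: 'k mpoly ring" by (rule domain_poly_ring)
  let ?M = "carrier (poly_ring A) - {0} :: 'k mpoly set"
  have "?M \<subseteq> carrier (poly_ring T)" using poly_ring_mono[OF T(2)] by auto
  moreover have "\<one>\<^bsub>poly_ring T\<^esub> \<in> ?M" using A.one_closed by simp
  moreover have "x \<otimes>\<^bsub>poly_ring T\<^esub> y \<in> ?M" if "x \<in> ?M" "y \<in> ?M" for x y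
    using that A.m_closed[of x y] by simp
  moreover have "J \<inter> ?M = {}" using indep by blast
  ultimately obtain P where P: "primeideal P (poly_ring T)" "J \<subseteq> P" "P \<inter> ?M = {}"
    by (rule T.exists_primeideal_disjoint[OF J])
  have "P \<inter> carrier (poly_ring A) = {0}"
    using P indep by blast
  then have "n \<le> card (T - A)"
    if "\<forall>i\<le>n. primeideal (C i) (poly_ring T)" "\<forall>i<n. C i \<subset> C (Suc i)" "C n = P" for n C
    using independent_prime_chain_bound[OF T, of C n] that T
    by (simp add: card_Diff_subset finite_subset)
  then have "prime_height (poly_ring T) P \<le> enat (card (T - A))"
    unfolding prime_height_def by (intro Sup_least) auto
  moreover have "height (poly_ring T) J \<le> prime_height (poly_ring T) P"
    unfolding height_def using P by (intro INF_lower) auto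
  ultimately show ?thesis by (rule order_trans[rotated])
qed

theorem theorem4p1:
  fixes N s :: nat
    and p :: "nat \<Rightarrow> 'k::field mpoly"
    and I :: "'k mpoly set"
    and \<Omega> :: "nat set"
  assumes "infinite (UNIV :: 'k set)"
    and "\<And>i. i \<in> {1..s} \<Longrightarrow> p i \<in> carrier (poly_ring {1..N})"
    and "I = Idl\<^bsub>poly_ring {1..N}\<^esub> (p ` {1..s})"
    and "I \<noteq> carrier (poly_ring {1..N})"
    and "\<Omega> \<subseteq> {1..N}"
    and "\<exists>T \<subseteq> {1..N}.
           height (poly_ring T) (Idl\<^bsub>poly_ring T\<^esub> (p ` {1..s} \<inter> carrier (poly_ring T)))
             > enat (card (T - \<Omega>))"
  shows "\<Omega> \<notin> independence_complex N I"
proof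
  assume "\<Omega> \<in> independence_complex N I"
  then have indep: "I \<inter> carrier (poly_ring \<Omega>) = {0}"
    by (simp add: independence_complex_def)
  from assms(6) obtain T where T: "T \<subseteq> {1..N}"
    and ht: "height (poly_ring T) (Idl\<^bsub>poly_ring T\<^esub> (p ` {1..s} \<inter> carrier (poly_ring T)))
             > enat (card (T - \<Omega>))" by blast
  interpret T: cring "poly_ring T :: 'k mpoly ring" by (rule cring_poly_ring)
  interpret N: cring "poly_ring {1..N} :: 'k mpoly ring" by (rule cring_poly_ring)
  let ?J = "Idl\<^bsub>poly_ring T\<^esub> (p ` {1..s} \<inter> carrier (poly_ring T))"
  have J: "ideal ?J (poly_ring T)" by (rule T.genideal_ideal) simp
  have gens: "p ` {1..s} \<subseteq> carrier (poly_ring {1..N})" using assms(2) by auto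
  interpret I: ideal I "poly_ring {1..N}"
    unfolding assms(3) by (rule N.genideal_ideal[OF gens])
  have "ideal (I \<inter> carrier (poly_ring T)) (poly_ring T)"
    using T I.is_ideal by (rule ideal_Int_poly_ring)
  then have "?J \<subseteq> I \<inter> carrier (poly_ring T)"
    by (rule T.genideal_minimal) (use N.genideal_self[OF gens] assms(3) in auto)
  moreover have "0 \<in> ?J"
    using additive_subgroup.zero_closed[OF ideal.axioms(1)[OF J]] by simp
  moreover have "carrier (poly_ring (T \<inter> \<Omega>)) \<subseteq> (carrier (poly_ring \<Omega>) :: 'k mpoly set)"
    by (rule poly_ring_mono) simp
  ultimately have "?J \<inter> carrier (poly_ring (T \<inter> \<Omega>)) = {0}"
    using indep by (auto simp: in_poly_ring_iff)
  from height_le_if_independent[OF _ _ J this]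
  have "height (poly_ring T) ?J \<le> enat (card (T - T \<inter> \<Omega>))"
    using finite_subset[OF T] by simp
  also have "T - T \<inter> \<Omega> = T - \<Omega>" by blast
  finally show False using ht by simp
qed

end
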